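(* Let $f_n(x)=2\xi_n(x^2)+x\zeta_n(x^2)$ for $n\geqslant 1$. Then $f_1(x)=2$ and $$f_{n+1}(x)=(1+x+(n-1)x^2)f_n(x)+x(1-x^2)\frac{\mathrm{d}}{\mathrm{d}x}f_n(x)\qquad(n\geqslant 1).$$ Moreover, for every $n\geqslant 1$: $f_n(x)\in\mathrm{RZ}[-1,0)$ and $f_n(x)$ interlaces $f_{n+1}(x)$; more precisely, $f_n(x)$ has $\lfloor\frac{n-1}{2}\rfloor$ simple zeros in the open interval $(-1,0)$ and the zero $x=-1$ with multiplicity $\lfloor\frac{n}{2}\rfloor$. Furthermore, both $\xi_n(x)$ and $\zeta_n(x)$ have only real negative simple zeros, $\zeta_{2n}(x)$ alternates left of $\xi_{2n}(x)$, and $\zeta_{2n+1}(x)$ interlaces $\xi_{2n+1}(x)$.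
   Context: For $\pi\in\mathfrak{S}_n$ with the convention $\pi(0)=0$, $\mathrm{udrun}(\pi)=1+\#\{i\in[n-1]:(\pi(i)-\pi(i-1))(\pi(i+1)-\pi(i))<0\}$ (the number of maximal contiguous monotone runs of $0\pi(1)\cdots\pi(n)$), and $T(n,k)$ is the number of $\pi\in\mathfrak{S}_n$ with $\mathrm{udrun}(\pi)=k$. Define $\xi_n(x)=\sum_{k\geqslant0}T(n,2k+1)x^k$ and $\zeta_n(x)=\sum_{k\geqslant0}2T(n,2k+2)x^k$. $\mathrm{RZ}[-1,0)$ denotes the set of real polynomials with only real zeros, all lying in $[-1,0)$. For real-rooted polynomials $p,q$ with zeros $\xi_1\leqslant\cdots\leqslant\xi_m$ of $p$ and $\theta_1\leqslant\cdots$ of $q$: $p$ interlaces $q$ if $\deg q=1+\deg p$ and $\theta_1\leqslant\xi_1\leqslant\theta_2\leqslant\cdots\leqslant\xi_m\leqslant\theta_{m+1}$; $p$ alternates left of $q$ if $\deg p=\deg q=m$ and $\xi_1\leqslant\theta_1\leqslant\xi_2\leqslant\cdots\leqslant\xi_m\leqslant\theta_m$.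
   Formalization: The claim that ζ_n(x) has only real negative simple zeros is stated for n ≥ 2 only, because ζ_1(x) is the zero polynomial, for which every number is a zero, so the claim fails at n = 1. *)

theory Defs
  imports
    Complex_Main
    "HOL-Combinatorics.Permutations"
    "HOL-Computational_Algebra.Polynomial"
begin

text \<open>
  A permutation of \<open>[n]\<close> is a function that permutes \<open>{1..n}\<close>. Such a function is the
  identity outside \<open>{1..n}\<close>, so the convention \<open>\<pi> 0 = 0\<close> holds automatically.
\<close>

definition udrun :: "nat \<Rightarrow> (nat \<Rightarrow> nat) \<Rightarrow> nat" where
  "udrun n \<pi> = 1 + card {i \<in> {1..n - 1}.
     (int (\<pi> i) - int (\<pi> (i - 1))) * (int (\<pi> (i + 1)) - int (\<pi> i)) < 0}"

definition T :: "nat \<Rightarrow> nat \<Rightarrow> nat" where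
  "T n k = card {\<pi>. \<pi> permutes {1..n} \<and> udrun n \<pi> = k}"

text \<open>
  The sums over all \<open>k \<ge> 0\<close> are cut off at \<open>k = n\<close>, beyond which all terms vanish; see
  \<open>coeff_xi_poly\<close> and \<open>coeff_zeta_poly\<close> below.
\<close>

definition xi_poly :: "nat \<Rightarrow> real poly" where
  "xi_poly n = (\<Sum>k\<le>n. monom (real (T n (2 * k + 1))) k)"

definition zeta_poly :: "nat \<Rightarrow> real poly" where
  "zeta_poly n = (\<Sum>k\<le>n. monom (2 * real (T n (2 * k + 2))) k)"

definition f_poly :: "nat \<Rightarrow> real poly" where
  "f_poly n = smult 2 (xi_poly n \<circ>\<^sub>p [:0, 0, 1:]) + [:0, 1:] * (zeta_poly n \<circ>\<^sub>p [:0, 0, 1:])"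

lemma udrun_le: "udrun n \<pi> \<le> n + 1"
proof -
  have "card {i \<in> {1..n - 1}.
     (int (\<pi> i) - int (\<pi> (i - 1))) * (int (\<pi> (i + 1)) - int (\<pi> i)) < 0} \<le> card {1..n - 1}"
    by (rule card_mono) auto
  then show ?thesis
    by (simp add: udrun_def)
qed

lemma T_eq_0: "T n k = 0" if "k > n + 1"
proof -
  have "{\<pi>. \<pi> permutes {1..n} \<and> udrun n \<pi> = k} = {}"
    using that udrun_le[of n] by (auto simp: not_le[symmetric])
  then show ?thesis
    unfolding T_def by (simp only: card.empty)
qed

lemma coeff_xi_poly: "coeff (xi_poly n) k = real (T n (2 * k + 1))"
  by (cases "k \<le> n") (auto simp: xi_poly_def coeff_sum T_eq_0)

lemma coeff_zeta_poly: "coeff (zeta_poly n) k = 2 * real (T n (2 * k + 2))"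
  by (cases "k \<le> n") (auto simp: zeta_poly_def coeff_sum T_eq_0)

text \<open>Since \<open>udrun 1 \<pi> = 1\<close>, the polynomial \<open>\<zeta>\<^sub>1\<close> is identically zero.\<close>

lemma zeta_poly_1: "zeta_poly 1 = 0"
  by (simp add: poly_eq_iff coeff_zeta_poly T_def udrun_def)

text \<open>
  The zeros of a real polynomial are always taken in \<open>\<complex>\<close>. In particular the zero polynomial,
  which vanishes on all of \<open>\<complex>\<close>, satisfies none of the following three conditions, while
  nonzero constants satisfy all of them.
\<close>

definition real_rooted :: "real poly \<Rightarrow> bool" where
  "real_rooted p \<longleftrightarrow>
     (\<forall>z. poly (map_poly complex_of_real p) z = 0 \<longrightarrow> z \<in> \<real>)"

definition RZ :: "real set \<Rightarrow> real poly set" where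
  "RZ S = {p. \<forall>z. poly (map_poly complex_of_real p) z = 0 \<longrightarrow> z \<in> complex_of_real ` S}"

definition only_real_negative_simple_zeros :: "real poly \<Rightarrow> bool" where
  "only_real_negative_simple_zeros p \<longleftrightarrow>
     (\<forall>z. poly (map_poly complex_of_real p) z = 0 \<longrightarrow>
        z \<in> complex_of_real ` {..<0} \<and> order z (map_poly complex_of_real p) = 1)"

text \<open>
  The real zeros in weakly increasing order, each repeated according to its multiplicity.
  For a real-rooted polynomial the length of this list is the degree.
\<close>

definition zeros :: "real poly \<Rightarrow> real list" where
  "zeros p = sorted_list_of_multiset (proots p)"

definition interlaces :: "real poly \<Rightarrow> real poly \<Rightarrow> bool" where
  "interlaces p q \<longleftrightarrow> real_rooted p \<and> real_rooted q \<and> degree q = 1 + degree p \<and>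
     (\<forall>i < degree p. zeros q ! i \<le> zeros p ! i \<and> zeros p ! i \<le> zeros q ! (i + 1))"

definition alternates_left :: "real poly \<Rightarrow> real poly \<Rightarrow> bool" where
  "alternates_left p q \<longleftrightarrow> real_rooted p \<and> real_rooted q \<and> degree p = degree q \<and>
     (\<forall>i < degree p. zeros p ! i \<le> zeros q ! i) \<and>
     (\<forall>i. i + 1 < degree p \<longrightarrow> zeros q ! i \<le> zeros p ! (i + 1))"

end

theory Submission
  imports Defs
begin

text \<open>
  Expanding both parts, \<open>f\<^sub>n = 2 \<Sum>\<^sub>\<pi> x\<^bsup>udrun \<pi> - 1\<^esup>\<close>. Inserting \<open>n + 1\<close> into a permutation of
  \<open>[n]\<close> with \<open>k\<close> runs yields \<open>k\<close>, \<open>1\<close> and \<open>n - k\<close> permutations with \<open>k\<close>, \<open>k + 1\<close> and \<open>k + 2\<close>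
  runs, which is the recurrence. Write \<open>f\<^sub>n = (1 + x)\<^sup>m g\<close> with \<open>m = \<lfloor>n / 2\<rfloor>\<close>. At a zero
  \<open>a \<in> (-1, 0)\<close> of \<open>g\<close> the next polynomial has the sign opposite to that of \<open>g'(a)\<close>, so sign
  changes at consecutive zeros of \<open>g\<close>, together with \<open>0\<close> and, for even \<open>n\<close>, \<open>-1\<close>, locate as many
  zeros as the degree allows. Finally, on the imaginary axis
  \<open>f\<^sub>n(\<i> y) = 2 \<xi>\<^sub>n(- y\<^sup>2) + \<i> y \<zeta>\<^sub>n(- y\<^sup>2)\<close> has increasing argument
  \<open>\<Sum>\<^sub>r arctan (y / r)\<close>, over the zeros \<open>- r\<close> of \<open>f\<^sub>n\<close>, so it is alternately imaginary and real
  at the points where the argument passes the multiples of \<open>\<pi> / 2\<close> (the Hermite--Biehler argument).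
\<close>

subsection \<open>The recurrence for \<open>f\<^sub>n\<close>\<close>

definition changes :: "nat \<Rightarrow> (nat \<Rightarrow> bool) \<Rightarrow> nat" where
  "changes n s = (\<Sum>i\<in>{1..<n}. of_bool (s i \<noteq> s (Suc i)))"

text \<open>
  A permutation is recorded by its ascent word \<open>s\<close>, where \<open>s i\<close> concerns the step from position
  \<open>i - 1\<close> to \<open>i\<close>. Inserting a new maximum after position \<open>j\<close> replaces step \<open>j + 1\<close> by an ascent
  and a descent; if \<open>j\<close> is the last position, the descent falls beyond the range considered.
\<close>

definition insert_peak :: "nat \<Rightarrow> (nat \<Rightarrow> bool) \<Rightarrow> nat \<Rightarrow> bool" where
  "insert_peak j s i =
     (if i \<le> j then s i else if i = Suc j then True else if i = Suc (Suc j) then False else s (i - 1))"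

text \<open>The growth of \<open>changes\<close> under insertion of a peak after position
  \<open>j\<close>, read off from the letters \<open>j\<close>, \<open>j + 1\<close> and
  \<open>j + 2\<close>. When \<open>s 1\<close> holds, the case \<open>j = 0\<close> with
  \<open>1 \<le> n\<close> never consults \<open>s 0\<close>.\<close>

definition new_changes :: "nat \<Rightarrow> (nat \<Rightarrow> bool) \<Rightarrow> nat \<Rightarrow> nat" where
  "new_changes n s j =
     (if j = n then of_bool (\<not> s n)
      else if s (Suc j) then (if Suc j = n then 1 else if s (Suc (Suc j)) then 2 else 0)
      else if s j then 0 else 2)"

lemma changes_Suc: "1 \<le> n \<Longrightarrow> changes (Suc n) s = changes n s + of_bool (s n \<noteq> s (Suc n))"
  by (simp add: changes_def)

lemma changes_1 [simp]: "changes (Suc 0) s = 0"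
  by (simp add: changes_def)

lemma changes_cong: "(\<And>i. 1 \<le> i \<Longrightarrow> i \<le> n \<Longrightarrow> s i = t i) \<Longrightarrow> changes n s = changes n t"
  unfolding changes_def by (intro sum.cong) auto

lemma changes_insert_peak_prefix:
  assumes "s 1"
  shows "changes (Suc j) (insert_peak j s) = (if j = 0 then 0 else changes j s + of_bool (\<not> s j))"
proof (cases "j = 0")
  case False
  have "changes j (insert_peak j s) = changes j s"
    by (rule changes_cong) (simp add: insert_peak_def)
  moreover have "insert_peak j s j = s j" "insert_peak j s (Suc j)"
    by (simp_all add: insert_peak_def)
  ultimately show ?thesis using False by (simp add: changes_Suc)
qed simp

text \<open>Behind the peak the new word is the old one shifted by one place, so lengthening both
  words adds the same changes. The induction therefore starts at \<open>n = Suc j\<close>, where the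
  peak ends the word.\<close>

lemma changes_insert_peak:
  assumes "s 1" "1 \<le> n" "j \<le> n"
  shows "changes (Suc n) (insert_peak j s) = changes n s + new_changes n s j"
proof (cases "j = n")
  case True
  then show ?thesis using changes_insert_peak_prefix[of s j] assms
    by (simp add: new_changes_def)
next
  case False
  then have "Suc j \<le> n" using assms by simp
  then show ?thesis
  proof (induction n rule: dec_induct)
    case base
    have "insert_peak j s (Suc j)" "\<not> insert_peak j s (Suc (Suc j))"
      by (simp_all add: insert_peak_def)
    then show ?case
      using changes_insert_peak_prefix[of s j] assms(1)
      by (cases "j = 0") (auto simp: changes_Suc new_changes_def)
  next
    case (step n)
    have "insert_peak j s (Suc (Suc n)) = s (Suc n)"
      using step by (simp add: insert_peak_def)
    moreover have "insert_peak j s (Suc n) = (if n = Suc j then False else s n)"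
      using step by (simp add: insert_peak_def)
    ultimately show ?case using step
      by (auto simp: changes_Suc new_changes_def)
  qed
qed

text \<open>With \<open>k = changes n s + 1\<close> runs, the exponents 0, 1 and 2 occur
  \<open>k\<close>, 1 and \<open>n - k\<close> times. A ring is used so that \<open>n - k\<close> is
  a true difference and \<open>x\<close> can later be the polynomial variable.\<close>

lemma sum_new_changes:
  fixes x :: "'a::comm_ring_1"
  assumes "s 1" "1 \<le> n"
  shows "(\<Sum>j\<le>n. x ^ new_changes n s j) =
    of_nat (changes n s + 1) + x + (of_nat n - 1 - of_nat (changes n s)) * x\<^sup>2"
  using assms(2)
proof (induction n rule: dec_induct)
  case base
  show ?case using assms(1) by (simp add: new_changes_def atMost_Suc)
next
  case (step n)
  obtain m where n: "n = Suc m" using step by (cases n) auto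
  define A where "A = (\<Sum>j<m. x ^ new_changes (Suc m) s j)"
  \<comment> \<open>For \<open>j < m\<close> the exponent depends on letters up to
    \<open>j + 2\<close>, hence at most \<open>n\<close>, so a further letter leaves these terms
    alone. The induction hypothesis determines their sum \<open>A\<close>.\<close>
  have A': "(\<Sum>j<m. x ^ new_changes (Suc (Suc m)) s j) = A"
    unfolding A_def by (intro sum.cong) (auto simp: new_changes_def)
  have "A + x ^ new_changes (Suc m) s m + x ^ new_changes (Suc m) s (Suc m)
      = of_nat (changes n s + 1) + x + (of_nat n - 1 - of_nat (changes n s)) * x\<^sup>2"
    using step.IH unfolding n A_def by (simp add: lessThan_Suc_atMost[symmetric])
  then have A: "A = of_nat (changes n s + 1) + x + (of_nat n - 1 - of_nat (changes n s)) * x\<^sup>2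
      - x ^ new_changes (Suc m) s m - x ^ new_changes (Suc m) s (Suc m)"
    by (simp add: eq_diff_eq add_ac)
  have "(\<Sum>j\<le>Suc n. x ^ new_changes (Suc n) s j) = A + x ^ new_changes (Suc n) s m
      + x ^ new_changes (Suc n) s (Suc m) + x ^ new_changes (Suc n) s (Suc (Suc m))"
    unfolding n by (simp add: lessThan_Suc_atMost[symmetric] A')
  then show ?case
    unfolding A n by (auto simp: new_changes_def changes_Suc algebra_simps)
qed

section \<open>From permutations to ascent words\<close>

definition ascent :: "(nat \<Rightarrow> nat) \<Rightarrow> nat \<Rightarrow> bool" where
  "ascent \<pi> i \<longleftrightarrow> \<pi> (i - 1) < \<pi> i"

lemma ascent_1:
  assumes "\<pi> permutes {1..n}" shows "ascent \<pi> 1"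
proof -
  have "\<pi> 0 = 0" "\<pi> 1 \<noteq> \<pi> 0"
    using assms permutes_not_in permutes_inj[OF assms] by (fastforce simp: inj_eq)+
  then show ?thesis by (simp add: ascent_def)
qed

text \<open>Injectivity makes neighbouring values distinct, so a negative product means that exactly
  one of the two steps ascends.\<close>

lemma udrun_changes:
  assumes "\<pi> permutes {1..n}"
  shows "udrun n \<pi> = 1 + changes n (ascent \<pi>)"
proof -
  have "{i \<in> {1..n - 1}. (int (\<pi> i) - int (\<pi> (i - 1))) * (int (\<pi> (i + 1)) - int (\<pi> i)) < 0}
      = {i \<in> {1..<n}. ascent \<pi> i \<noteq> ascent \<pi> (Suc i)}" (is "?A = ?B")
  proof -
    have "(int (\<pi> i) - int (\<pi> (i - 1))) * (int (\<pi> (i + 1)) - int (\<pi> i)) < 0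
        \<longleftrightarrow> ascent \<pi> i \<noteq> ascent \<pi> (Suc i)" if "1 \<le> i" for i
    proof -
      have "\<pi> (i - 1) \<noteq> \<pi> i" "\<pi> (i + 1) \<noteq> \<pi> i"
        using permutes_inj[OF assms] that by (auto simp: inj_eq)
      then show ?thesis by (auto simp: ascent_def mult_less_0_iff)
    qed
    then show ?thesis by force
  qed
  then show ?thesis
    unfolding udrun_def changes_def by (simp add: of_bool_def sum.If_cases Int_def)
qed

text \<open>\<open>\<pi> \<circ> shift_cycle n j\<close> is \<open>\<pi>\<close> with \<open>n + 1\<close> inserted after position \<open>j\<close>.\<close>

definition shift_cycle :: "nat \<Rightarrow> nat \<Rightarrow> nat \<Rightarrow> nat" where
  "shift_cycle n j i =
     (if i = Suc j then Suc n else if Suc j < i \<and> i \<le> Suc n then i - 1 else i)"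

lemma shift_cycle_permutes:
  assumes "j \<le> n" shows "shift_cycle n j permutes {1..Suc n}"
proof (rule bij_imp_permutes)
  have "inj_on (shift_cycle n j) {1..Suc n}"
    using assms by (auto simp: inj_on_def shift_cycle_def split: if_splits)
  moreover have "shift_cycle n j ` {1..Suc n} \<subseteq> {1..Suc n}"
    using assms by (auto simp: shift_cycle_def)
  ultimately show "bij_betw (shift_cycle n j) {1..Suc n} {1..Suc n}"
    unfolding bij_betw_def by (meson endo_inj_surj finite_atLeastAtMost)
qed (use assms in \<open>auto simp: shift_cycle_def\<close>)

text \<open>The position of \<open>n + 1\<close> reveals \<open>j\<close>, and cancelling the
  surjective shift then reveals \<open>\<pi>\<close>. Injectivity suffices, since both sides have
  \<open>(n + 1)!\<close> elements.\<close>

lemma bij_betw_insert_max: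
  "bij_betw (\<lambda>(\<pi>, j). \<pi> \<circ> shift_cycle n j) ({\<pi>. \<pi> permutes {1..n}} \<times> {..n})
     {\<pi>. \<pi> permutes {1..Suc n}}" (is "bij_betw ?h ?A ?B")
proof -
  have ext: "\<pi> permutes {1..Suc n}" if "\<pi> permutes {1..n}" for \<pi>
    using that by (rule permutes_subset) auto
  have "inj_on ?h ?A"
  proof (rule inj_onI)
    fix p q assume "p \<in> ?A" "q \<in> ?A" "?h p = ?h q"
    then obtain \<pi> j \<pi>' j' where pq: "p = (\<pi>, j)" "q = (\<pi>', j')"
      and *: "\<pi> permutes {1..n}" "\<pi>' permutes {1..n}" "j \<in> {..n}" "j' \<in> {..n}"
      and eq: "\<pi> \<circ> shift_cycle n j = \<pi>' \<circ> shift_cycle n j'"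
      by (cases p; cases q) auto
    have fix_max: "\<pi> (Suc n) = Suc n" "\<pi>' (Suc n) = Suc n"
      using * permutes_not_in by fastforce+
    have "\<pi>' (shift_cycle n j' (Suc j)) = \<pi> (shift_cycle n j (Suc j))"
      using eq by (metis comp_apply)
    also have "\<dots> = \<pi>' (shift_cycle n j' (Suc j'))"
      by (simp add: shift_cycle_def fix_max)
    finally have "j = j'"
      using permutes_inj[OF *(2)] permutes_inj[OF shift_cycle_permutes, of j' n] *(4)
      by (auto simp: inj_eq)
    moreover have "surj (shift_cycle n j)"
      using shift_cycle_permutes *(3) permutes_surj by blast
    ultimately show "p = q"
      unfolding pq using eq by (metis surj_fun_eq UNIV_I ext)
  qed
  moreover have "?h ` ?A \<subseteq> ?B"
    using permutes_compose[OF shift_cycle_permutes ext] by auto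
  moreover have "card ?A = card ?B"
    by (simp add: card_cartesian_product card_permutations)
  moreover have "finite ?B"
    by (simp add: finite_permutations)
  ultimately show ?thesis
    by (simp add: bij_betw_def card_image card_subset_eq)
qed

text \<open>The inserted value exceeds all others, so one ascends to it and descends from it. For
  \<open>j = n\<close> the words disagree at \<open>n + 2\<close>, which explains the bound on
  \<open>i\<close>.\<close>

lemma ascent_insert_max:
  assumes "\<pi> permutes {1..n}" "j \<le> n" "1 \<le> i" "i \<le> Suc n"
  shows "ascent (\<pi> \<circ> shift_cycle n j) i = insert_peak j (ascent \<pi>) i"
proof -
  have "\<pi> i \<le> n" if "i \<le> n" for i
    using permutes_in_image[OF assms(1), of i] permutes_not_in[OF assms(1), of i] that
    by (cases "i \<in> {1..n}") auto
  moreover from this have "\<pi> i < Suc n" if "i \<le> n" for i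
    using that by (simp add: less_Suc_eq_le)
  moreover have "\<pi> (Suc n) = Suc n"
    using assms(1) permutes_not_in by fastforce
  moreover have "i - 2 = i - 1 - 1" by simp
  ultimately show ?thesis
    using assms(2-4) by (auto simp: ascent_def shift_cycle_def insert_peak_def not_less
        intro: le_SucI)
qed

lemma udrun_insert_max:
  assumes "\<pi> permutes {1..n}" "j \<le> n" "1 \<le> n"
  shows "udrun (Suc n) (\<pi> \<circ> shift_cycle n j) = udrun n \<pi> + new_changes n (ascent \<pi>) j"
proof -
  have "\<pi> \<circ> shift_cycle n j permutes {1..Suc n}"
    using bij_betw_insert_max[of n] assms by (auto simp: bij_betw_def)
  then have "udrun (Suc n) (\<pi> \<circ> shift_cycle n j)
      = 1 + changes (Suc n) (ascent (\<pi> \<circ> shift_cycle n j))"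
    by (rule udrun_changes)
  also have "changes (Suc n) (ascent (\<pi> \<circ> shift_cycle n j))
      = changes (Suc n) (insert_peak j (ascent \<pi>))"
    using assms by (intro changes_cong ascent_insert_max) auto
  also have "\<dots> = changes n (ascent \<pi>) + new_changes n (ascent \<pi>) j"
  proof (rule changes_insert_peak)
    show "ascent \<pi> 1" by (rule ascent_1[OF assms(1)])
  qed (use assms in auto)
  finally show ?thesis
    by (simp only: udrun_changes[OF assms(1)] add.assoc)
qed

section \<open>The generating polynomial of the number of runs\<close>

lemma coeff_pcompose_square:
  "coeff (p \<circ>\<^sub>p [:0, 0, 1:]) k = (if even k then coeff p (k div 2) else 0)"
  for p :: "'a::comm_semiring_1 poly"
proof (induction p arbitrary: k)
  case (pCons a p)
  have "[:0, 0, 1:] * q = pCons 0 (pCons 0 q)" for q :: "'a poly"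
    by (simp add: smult_1_left)
  then have "pCons a p \<circ>\<^sub>p [:0, 0, 1:] = pCons a (pCons 0 (p \<circ>\<^sub>p [:0, 0, 1:]))"
    by (simp add: pcompose_pCons)
  then show ?case
    by (auto simp: coeff_pCons pCons.IH split: nat.split)
qed simp

lemma coeff_f_poly: "coeff (f_poly n) k = 2 * real (T n (k + 1))"
  by (auto simp: f_poly_def coeff_pcompose_square coeff_xi_poly coeff_zeta_poly coeff_pCons
      elim!: oddE evenE split: nat.split)

lemma f_poly_sum:
  "f_poly n = smult 2 (\<Sum>\<pi> | \<pi> permutes {1..n}. [:0, 1:] ^ (udrun n \<pi> - 1))"
proof (rule poly_eqI)
  fix k
  have fin: "finite {\<pi>. \<pi> permutes {1..n}}" by (simp add: finite_permutations)
  have "(\<Sum>\<pi> | \<pi> permutes {1..n}. coeff ([:0, 1::real:] ^ (udrun n \<pi> - 1)) k)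
      = (\<Sum>\<pi> | \<pi> permutes {1..n}. of_bool (udrun n \<pi> = k + 1))"
    by (intro sum.cong) (auto simp: monom_altdef[of 1, simplified, symmetric] udrun_def)
  also have "\<dots> = real (T n (k + 1))"
    using fin unfolding T_def by (simp add: of_bool_def sum.If_cases Int_def)
  finally show "coeff (f_poly n) k =
      coeff (smult 2 (\<Sum>\<pi> | \<pi> permutes {1..n}. [:0, 1:] ^ (udrun n \<pi> - 1))) k"
    by (simp add: coeff_f_poly coeff_sum)
qed

text \<open>The Euler operator turns the number of changes, which appears as a coefficient, into a
  derivative.\<close>

lemma x_pderiv_power: "[:0, 1:] * pderiv ([:0, 1:] ^ m) = of_nat m * [:0, 1:] ^ m"
  for m :: nat
proof (cases m)
  case (Suc k)
  have "pderiv [:0, 1:] = (1 :: 'a poly)" by (simp add: pderiv_pCons)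
  then show ?thesis unfolding Suc by (simp only: pderiv_power_Suc) (simp add: of_nat_poly)
qed simp

lemma pderiv_sum: "pderiv (sum p A) = (\<Sum>a\<in>A. pderiv (p a))"
  by (induction A rule: infinite_finite_induct) (simp_all add: pderiv_add)

text \<open>Permutations of \<open>[n + 1]\<close> are grouped by what remains after deleting the
  maximum. A permutation with \<open>m\<close> changes then contributes \<open>x^m\<close> times the
  sum from \<open>sum_new_changes\<close>.\<close>

lemma f_poly_Suc:
  assumes "1 \<le> n"
  shows "f_poly (Suc n) =
    [:1, 1, real n - 1:] * f_poly n + [:0, 1:] * [:1, 0, -1:] * pderiv (f_poly n)"
proof -
  let ?X = "[:0, 1:] :: real poly"
  let ?S = "\<lambda>n. {\<pi>. \<pi> permutes {1..n}}"
  have step: "(\<Sum>j\<le>n. ?X ^ (udrun (Suc n) (\<pi> \<circ> shift_cycle n j) - 1)) =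
      [:1, 1, real n - 1:] * ?X ^ (udrun n \<pi> - 1)
      + ?X * [:1, 0, -1:] * pderiv (?X ^ (udrun n \<pi> - 1))" if \<pi>: "\<pi> permutes {1..n}" for \<pi>
  proof -
    define m where "m = changes n (ascent \<pi>)"
    have m: "udrun n \<pi> = Suc m" using udrun_changes[OF \<pi>] by (simp add: m_def)
    have "(\<Sum>j\<le>n. ?X ^ (udrun (Suc n) (\<pi> \<circ> shift_cycle n j) - 1)) =
        ?X ^ m * (\<Sum>j\<le>n. ?X ^ new_changes n (ascent \<pi>) j)"
      using udrun_insert_max[OF \<pi> _ assms] m by (simp add: power_add sum_distrib_left)
    also have "(\<Sum>j\<le>n. ?X ^ new_changes n (ascent \<pi>) j)
        = of_nat (m + 1) + ?X + (of_nat n - 1 - of_nat m) * ?X\<^sup>2"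
      unfolding m_def using sum_new_changes[of "ascent \<pi>" n ?X] ascent_1[OF \<pi>] assms by simp
    \<comment> \<open>The terms carrying the factor \<open>m\<close> are split off, ready to become
      the derivative term.\<close>
    also have "?X ^ m * \<dots> = (1 + ?X + (of_nat n - 1) * ?X\<^sup>2) * ?X ^ m
        + (1 - ?X\<^sup>2) * (of_nat m * ?X ^ m)"
      by (simp add: algebra_simps)
    also have "1 + ?X + (of_nat n - 1) * ?X\<^sup>2 = [:1, 1, real n - 1:]"
      by (simp add: of_nat_poly power2_eq_square one_pCons)
    also have "1 - ?X\<^sup>2 = [:1, 0, -1:]"
      by (simp add: power2_eq_square one_pCons)
    also have "of_nat m * ?X ^ m = ?X * pderiv (?X ^ m)"
      by (simp only: x_pderiv_power)
    finally show ?thesis by (simp only: m) (simp only: diff_Suc_1 mult.assoc mult.left_commute)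
  qed
  have "(\<Sum>\<pi>\<in>?S (Suc n). ?X ^ (udrun (Suc n) \<pi> - 1)) =
      (\<Sum>(\<pi>, j)\<in>?S n \<times> {..n}. ?X ^ (udrun (Suc n) (\<pi> \<circ> shift_cycle n j) - 1))"
    by (subst sum.reindex_bij_betw[OF bij_betw_insert_max, symmetric]) (simp add: case_prod_unfold)
  also have "\<dots> = (\<Sum>\<pi>\<in>?S n. \<Sum>j\<le>n. ?X ^ (udrun (Suc n) (\<pi> \<circ> shift_cycle n j) - 1))"
    by (simp add: sum.cartesian_product)
  also have "\<dots> = (\<Sum>\<pi>\<in>?S n. [:1, 1, real n - 1:] * ?X ^ (udrun n \<pi> - 1)
      + ?X * [:1, 0, -1:] * pderiv (?X ^ (udrun n \<pi> - 1)))"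
    by (rule sum.cong[OF refl], rule step) simp
  finally show ?thesis
    unfolding f_poly_sum
    by (simp only: sum.distrib sum_distrib_left[symmetric] pderiv_smult pderiv_sum
        smult_add_right mult_smult_right)
qed

subsection \<open>Polynomials given by their zeros\<close>

lemma linear_factors_neq_0: "(\<Prod>x\<leftarrow>xs. [:- x, 1:]) \<noteq> (0 :: 'a::idom poly)"
  by (auto simp: prod_list_zero_iff)

lemma proots_linear_factors:
  fixes c :: "'a::idom"
  assumes "c \<noteq> 0"
  shows "proots (smult c (\<Prod>x\<leftarrow>xs. [:- x, 1:])) = mset xs"
proof -
  have "proots (\<Prod>x\<leftarrow>xs. [:- x, 1:]) = mset xs"
    by (induction xs) (simp_all add: proots_mult linear_factors_neq_0 del: mult_pCons_left)
  then show ?thesis using assms by simp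
qed

lemma zeros_linear_factors:
  assumes "c \<noteq> 0" "sorted xs"
  shows "zeros (smult c (\<Prod>x\<leftarrow>xs. [:- x, 1:])) = xs"
  unfolding zeros_def proots_linear_factors[OF assms(1)]
  using assms(2) by (simp add: sorted_sort_id)

lemma poly_linear_factors:
  "poly (\<Prod>x\<leftarrow>xs. [:- x, 1:]) a = (\<Prod>x\<leftarrow>xs. a - x)" for a :: "'a::comm_ring_1"
  by (induction xs) (simp_all del: mult_pCons_left)

lemma order_linear_factors:
  fixes c :: "'a::idom"
  assumes "c \<noteq> 0"
  shows "order a (smult c (\<Prod>x\<leftarrow>xs. [:- x, 1:])) = count (mset xs) a"
  using assms linear_factors_neq_0[of xs]
  by (metis count_proots proots_linear_factors smult_eq_0_iff)

text \<open>Zeros are divided out one at a time; by distinctness the remaining ones are still zeros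
  of the quotient.\<close>

lemma linear_factors_eqI:
  fixes p :: "'a::idom poly"
  assumes "p \<noteq> 0" "distinct xs" "length xs = degree p" "\<forall>x\<in>set xs. poly p x = 0"
  shows "p = smult (lead_coeff p) (\<Prod>x\<leftarrow>xs. [:- x, 1:])"
  using assms
proof (induction xs arbitrary: p)
  case Nil
  then show ?case by (auto elim: degree_eq_zeroE)
next
  case (Cons x xs)
  then obtain q where q: "p = [:- x, 1:] * q"
    by (auto simp: poly_eq_0_iff_dvd)
  then have "q \<noteq> 0" using Cons by auto
  moreover have "degree p = Suc (degree q)"
    unfolding q using \<open>q \<noteq> 0\<close> by (subst degree_mult_eq) auto
  moreover have "poly q a = 0" if "a \<in> set xs" for a
    using Cons.prems that by (auto simp: q)
  ultimately have q': "q = smult (lead_coeff q) (\<Prod>x\<leftarrow>xs. [:- x, 1:])"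
    using Cons.prems by (intro Cons.IH) auto
  have "lead_coeff p = lead_coeff q"
    unfolding q lead_coeff_mult by simp
  then have "smult (lead_coeff p) (\<Prod>x\<leftarrow>x # xs. [:- x, 1:]) =
      [:- x, 1:] * smult (lead_coeff q) (\<Prod>x\<leftarrow>xs. [:- x, 1:])"
    by (simp only: list.map prod_list.Cons mult_smult_right)
  then show ?case
    using q q' by simp
qed

section \<open>Transfer of real factorizations to the complex numbers\<close>

abbreviation complex_poly :: "real poly \<Rightarrow> complex poly" where
  "complex_poly \<equiv> map_poly complex_of_real"

lemma complex_poly_add: "complex_poly (p + q) = complex_poly p + complex_poly q"
  by (intro poly_eqI) (simp add: coeff_map_poly)

lemma complex_poly_mult: "complex_poly (p * q) = complex_poly p * complex_poly q"
  by (intro poly_eqI) (simp add: coeff_map_poly coeff_mult)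

lemma complex_poly_smult: "complex_poly (smult c p) = smult (complex_of_real c) (complex_poly p)"
  by (intro poly_eqI) (simp add: coeff_map_poly)

lemma complex_poly_linear_factors:
  "complex_poly (smult c (\<Prod>x\<leftarrow>xs. [:- x, 1:])) =
     smult (complex_of_real c) (\<Prod>x\<leftarrow>map complex_of_real xs. [:- x, 1:])"
proof -
  have "complex_poly (\<Prod>x\<leftarrow>xs. [:- x, 1:]) = (\<Prod>x\<leftarrow>map complex_of_real xs. [:- x, 1:])"
    by (induction xs) (simp_all add: complex_poly_mult map_poly_pCons del: mult_pCons_left)
  then show ?thesis by (simp add: complex_poly_smult)
qed

lemma complex_zeros_linear_factors:
  assumes "c \<noteq> 0"
  shows "poly (complex_poly (smult c (\<Prod>x\<leftarrow>xs. [:- x, 1:]))) z = 0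
    \<longleftrightarrow> z \<in> complex_of_real ` set xs"
  unfolding complex_poly_linear_factors poly_smult poly_linear_factors
  using assms by (simp add: prod_list_zero_iff image_iff)

lemma real_rooted_linear_factors:
  assumes "c \<noteq> 0" shows "real_rooted (smult c (\<Prod>x\<leftarrow>xs. [:- x, 1:]))"
  unfolding real_rooted_def complex_zeros_linear_factors[OF assms] by auto

lemma only_real_negative_simple_zeros_linear_factors:
  assumes "c \<noteq> 0" "distinct xs" "set xs \<subseteq> {..<0}"
  shows "only_real_negative_simple_zeros (smult c (\<Prod>x\<leftarrow>xs. [:- x, 1:]))"
  unfolding only_real_negative_simple_zeros_def complex_zeros_linear_factors[OF assms(1)]
proof (intro allI impI)
  fix z assume z: "z \<in> complex_of_real ` set xs"
  moreover have "distinct (map complex_of_real xs)"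
    using assms(2) by (simp add: distinct_map inj_on_def)
  ultimately have "order z (complex_poly (smult c (\<Prod>x\<leftarrow>xs. [:- x, 1:]))) = 1"
    unfolding complex_poly_linear_factors using assms(1)
    by (subst order_linear_factors) (auto simp: distinct_count_atmost_1)
  then show "z \<in> complex_of_real ` {..<0} \<and>
      order z (complex_poly (smult c (\<Prod>x\<leftarrow>xs. [:- x, 1:]))) = 1"
    using z assms(3) by auto
qed

section \<open>Signs at zeros and localization by sign changes\<close>

lemma prod_list_diff_pos:
  "\<forall>b\<in>set xs. b < a \<Longrightarrow> 0 < (\<Prod>x\<leftarrow>xs. a - x)" for a :: real
  by (induction xs) simp_all

lemma prod_list_diff_neg:
  "\<forall>b\<in>set xs. a < b \<Longrightarrow> 0 < (- 1) ^ length xs * (\<Prod>x\<leftarrow>xs. a - x)" for a :: real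
proof (induction xs)
  case (Cons b xs)
  then have "0 < (b - a) * ((- 1) ^ length xs * (\<Prod>x\<leftarrow>xs. a - x))"
    by (intro mult_pos_pos[OF _ Cons.IH]) auto
  also have "\<dots> = (- 1) ^ length (b # xs) * (\<Prod>x\<leftarrow>b # xs. a - x)"
    by (simp add: algebra_simps)
  finally show ?case .
qed simp

lemma pderiv_simple_zero:
  "poly (pderiv ([:- a, 1:] * q)) a = poly q a" for a :: "'a::idom"
  by (simp add: pderiv_mult pderiv_pCons del: mult_pCons_left)

text \<open>At a simple zero the derivative is the product of the other factors. The negative ones
  belong to the \<open>length xs - Suc i\<close> larger zeros.\<close>

lemma sign_pderiv_linear_factors:
  fixes c :: real
  assumes "0 < c" "sorted_wrt (<) xs" "i < length xs"
  shows "0 < (- 1) ^ (length xs - Suc i) *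
    poly (pderiv (smult c (\<Prod>x\<leftarrow>xs. [:- x, 1:]))) (xs ! i)"
proof -
  define us vs where "us = take i xs" and "vs = drop (Suc i) xs"
  define a where "a = xs ! i"
  have xs: "xs = us @ a # vs"
    using id_take_nth_drop[OF assms(3)] by (simp add: us_def vs_def a_def)
  have less: "\<forall>b\<in>set us. b < a" "\<forall>b\<in>set vs. a < b"
    using assms(2) unfolding xs by (auto simp: sorted_wrt_append)
  let ?q = "smult c ((\<Prod>x\<leftarrow>us. [:- x, 1:]) * (\<Prod>x\<leftarrow>vs. [:- x, 1:]))"
  have "smult c (\<Prod>x\<leftarrow>xs. [:- x, 1:]) = [:- a, 1:] * ?q"
    unfolding xs by (simp del: mult_pCons_left add: mult.left_commute)
  then have "poly (pderiv (smult c (\<Prod>x\<leftarrow>xs. [:- x, 1:]))) a = poly ?q a"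
    by (simp only: pderiv_simple_zero)
  also have "\<dots> = c * (\<Prod>x\<leftarrow>us. a - x) * (\<Prod>x\<leftarrow>vs. a - x)"
    by (simp add: poly_linear_factors)
  finally have "(- 1) ^ length vs * poly (pderiv (smult c (\<Prod>x\<leftarrow>xs. [:- x, 1:]))) a
      = c * (\<Prod>x\<leftarrow>us. a - x) * ((- 1) ^ length vs * (\<Prod>x\<leftarrow>vs. a - x))"
    by simp
  also have "\<dots> > 0"
    using assms(1) less by (intro mult_pos_pos prod_list_diff_pos prod_list_diff_neg) auto
  finally show ?thesis
    unfolding a_def by (simp add: vs_def)
qed

lemma sorted_wrt_less_nth_SucI:
  fixes xs :: "'a::linorder list"
  shows "(\<And>i. Suc i < length xs \<Longrightarrow> xs ! i < xs ! Suc i) \<Longrightarrow> sorted_wrt (<) xs"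
  by (simp add: sorted_wrt_iff_nth_Suc_transp)

text \<open>The intermediate value theorem gives a zero in each of the \<open>degree q\<close> gaps,
  so these are all zeros and each is simple.\<close>

lemma zeros_between_sign_changes:
  fixes q :: "real poly"
  assumes len: "length ys = Suc (degree q)"
    and sorted: "\<And>i. i < degree q \<Longrightarrow> ys ! i < ys ! Suc i"
    and sign: "\<And>i. i \<le> degree q \<Longrightarrow> 0 < (- 1) ^ (degree q - i) * poly q (ys ! i)"
  obtains zs where "length zs = degree q" "sorted_wrt (<) zs"
    "\<And>i. i < degree q \<Longrightarrow> ys ! i < zs ! i \<and> zs ! i < ys ! Suc i"
    "q = smult (lead_coeff q) (\<Prod>x\<leftarrow>zs. [:- x, 1:])"
proof -
  have "\<exists>x. ys ! i < x \<and> x < ys ! Suc i \<and> poly q x = 0" if "i < degree q" for i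
  proof -
    have "degree q - i = Suc (degree q - Suc i)" using that by simp
    then have "0 < - ((- 1) ^ (degree q - Suc i) * poly q (ys ! i))"
      "0 < (- 1) ^ (degree q - Suc i) * poly q (ys ! Suc i)"
      using sign[of i] sign[of "Suc i"] that by simp_all
    then have "poly q (ys ! i) * poly q (ys ! Suc i) < 0"
      by (cases "even (degree q - Suc i)") (auto simp: mult_less_0_iff)
    then show ?thesis using poly_IVT[OF sorted[OF that]] by blast
  qed
  then obtain z where z: "\<And>i. i < degree q \<Longrightarrow> ys ! i < z i \<and> z i < ys ! Suc i \<and> poly q (z i) = 0"
    by metis
  define zs where "zs = map z [0..<degree q]"
  have sorted_zs: "sorted_wrt (<) zs"
    by (rule sorted_wrt_less_nth_SucI) (use z in \<open>auto simp: zs_def intro: less_trans\<close>)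
  have "q \<noteq> 0" using sign[of 0] by auto
  then have "q = smult (lead_coeff q) (\<Prod>x\<leftarrow>zs. [:- x, 1:])"
    using z sorted_zs by (intro linear_factors_eqI) (auto simp: zs_def strict_sorted_iff)
  then show thesis
    using z sorted_zs by (intro that[of zs]) (auto simp: zs_def)
qed

subsection \<open>The zeros of \<open>f\<^sub>n\<close>\<close>

lemma f_poly_1: "f_poly 1 = [:2:]"
proof -
  have "{\<pi>. \<pi> permutes {1..1::nat}} = {id}" by auto
  then show ?thesis
    by (simp add: f_poly_sum udrun_def)
qed

lemma coeff_f_poly_Suc:
  assumes "1 \<le> n"
  shows "coeff (f_poly (Suc n)) 0 = coeff (f_poly n) 0"
    "coeff (f_poly (Suc n)) (Suc 0) = 2 * coeff (f_poly n) (Suc 0) + coeff (f_poly n) 0"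
    "coeff (f_poly (Suc n)) (Suc (Suc k)) = (real k + 3) * coeff (f_poly n) (Suc (Suc k))
       + coeff (f_poly n) (Suc k) + (real n - 1 - real k) * coeff (f_poly n) k"
  unfolding f_poly_Suc[OF assms]
  by (auto simp: coeff_pCons coeff_pderiv algebra_simps split: nat.split)

text \<open>In the coefficient recurrence the factor \<open>n - 1 - k\<close> is nonnegative in the
  relevant range and the middle term is positive. This yields the degree and the sign of the leading
  coefficient.\<close>

lemma coeff_f_poly_pos:
  assumes "k < n" shows "0 < coeff (f_poly n) k"
proof -
  have "1 \<le> n" using assms by simp
  then show ?thesis using assms
  proof (induction n arbitrary: k rule: dec_induct)
    case base
    then show ?case by (simp add: f_poly_1[simplified])
  next
    case (step n)
    have nonneg: "0 \<le> coeff (f_poly n) j" for j by (simp add: coeff_f_poly)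
    consider "k = 0" | "k = Suc 0" | j where "k = Suc (Suc j)" by (metis nat.exhaust)
    then show ?case
    proof cases
      case 3
      then have "0 < coeff (f_poly n) (Suc j)" "0 \<le> real n - 1 - real j"
        using step by auto
      then have "0 < (real j + 3) * coeff (f_poly n) (Suc (Suc j)) + coeff (f_poly n) (Suc j)
          + (real n - 1 - real j) * coeff (f_poly n) j"
        by (intro add_pos_nonneg add_nonneg_pos mult_nonneg_nonneg nonneg) auto
      then show ?thesis
        using step by (simp add: 3 coeff_f_poly_Suc)
    qed (use step nonneg in \<open>auto simp: coeff_f_poly_Suc intro!: add_nonneg_pos\<close>)
  qed
qed

lemma coeff_f_poly_eq_0:
  assumes "1 \<le> n" "n \<le> k" shows "coeff (f_poly n) k = 0"
  using assms
proof (induction n arbitrary: k rule: dec_induct)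
  case base
  then show ?case by (cases k) (simp_all add: f_poly_1[simplified])
next
  case (step n)
  then have "k = Suc (Suc (k - 2))" by simp
  then obtain j where k: "k = Suc (Suc j)" by blast
  \<comment> \<open>In the boundary case \<open>n = Suc j\<close> the factor
    \<open>n - 1 - j\<close> of the last term vanishes.\<close>
  then have "n = Suc j \<or> coeff (f_poly n) j = 0"
    using step by (cases "n \<le> j") auto
  then show ?case using step by (auto simp: k coeff_f_poly_Suc)
qed

lemma f_poly_neq_0: "1 \<le> n \<Longrightarrow> f_poly n \<noteq> 0"
  using coeff_f_poly_pos[of 0 n] by auto

lemma degree_f_poly: "1 \<le> n \<Longrightarrow> degree (f_poly n) = n - 1"
  using coeff_f_poly_pos[of "n - 1" n] coeff_f_poly_eq_0[of n]
  by (intro antisym degree_le le_degree) auto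

text \<open>Since \<open>(1 - x^2) d/dx (1 + x)^m = m (1 - x) (1 + x)^m\<close>, the recurrence
  preserves the power of \<open>1 + x\<close> and induces a recurrence for the cofactor.\<close>

lemma f_poly_Suc_factor:
  assumes "1 \<le> n" "f_poly n = [:1, 1:] ^ m * g"
  shows "f_poly (Suc n) = [:1, 1:] ^ m *
    ([:1, 1 + real m, real n - 1 - real m:] * g + [:0, 1, 0, -1:] * pderiv g)"
proof -
  have deriv: "[:1, 0, -1:] * pderiv ([:1, 1:] ^ m) = [:real m, - real m:] * [:1, 1:] ^ m"
  proof (cases m)
    case (Suc k)
    have "pderiv [:1, 1:] = (1 :: real poly)" by (simp add: pderiv_pCons)
    then have "pderiv ([:1, 1:] ^ m) = [:real m:] * [:1, 1:] ^ k"
      unfolding Suc pderiv_power_Suc by simp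
    then have "[:1, 0, -1:] * pderiv ([:1, 1:] ^ m) = ([:1, 0, -1:] * [:real m:]) * [:1, 1:] ^ k"
      by (simp only: mult.assoc)
    also have "[:1, 0, -1:] * [:real m:] = [:real m, - real m:] * [:1, 1:]"
      by simp
    finally show ?thesis unfolding Suc by (simp only: power_Suc mult.assoc)
  qed simp
  have expand: "A * (P * g) + X * B * (P * g' + g * P') = P * ((A + X * R) * g + X * B * g')"
    if "B * P' = R * P" for A B P P' R X g g' :: "real poly"
  proof -
    have "X * B * (P * g' + g * P') = X * g * (B * P') + P * (X * B * g')"
      by (simp only: algebra_simps)
    then show ?thesis unfolding that by (simp only: algebra_simps)
  qed
  have coeffs: "[:1, 1, real n - 1:] + [:0, 1:] * [:real m, - real m:]
      = [:1, 1 + real m, real n - 1 - real m:]" "[:0, 1:] * [:1, 0, -1:] = [:0, 1, 0, -1::real:]"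
    by simp_all
  show ?thesis
    unfolding f_poly_Suc[OF assms(1)] assms(2) pderiv_mult[of "[:1, 1:] ^ m"] expand[OF deriv]
    unfolding coeffs ..
qed

definition f_zeros :: "nat \<Rightarrow> real list \<Rightarrow> real list" where
  "f_zeros n xs = replicate (n div 2) (- 1) @ xs"

text \<open>The invariant of the induction on \<open>n\<close>. Strict sortedness of
  \<open>xs\<close> encodes simplicity of the zeros inside the open interval.\<close>

definition is_f_factorization :: "nat \<Rightarrow> real \<Rightarrow> real list \<Rightarrow> bool" where
  "is_f_factorization n c xs \<longleftrightarrow> 0 < c \<and> sorted_wrt (<) xs \<and> set xs \<subseteq> {-1<..<0} \<and>
     length xs = (n - 1) div 2 \<and> f_poly n = smult c (\<Prod>x\<leftarrow>f_zeros n xs. [:- x, 1:])"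

lemma f_zeros_prod: "(\<Prod>x\<leftarrow>f_zeros n xs. [:- x, 1:]) = [:1, 1:] ^ (n div 2) * (\<Prod>x\<leftarrow>xs. [:- x, 1:])"
  by (simp add: f_zeros_def)

lemma nth_f_zeros: "f_zeros n xs ! i = (if i < n div 2 then - 1 else xs ! (i - n div 2))"
  by (auto simp: f_zeros_def nth_append)

text \<open>The cofactor \<open>q\<close> has degree \<open>n - Suc n div 2 = n div 2\<close>, so
  \<open>n div 2 + 1\<close> points of alternating sign in \<open>[-1, 0]\<close> locate all its
  zeros.\<close>

lemma f_factorization_of_sign_changes:
  assumes n: "1 \<le> n" and q: "f_poly (Suc n) = [:1, 1:] ^ (Suc n div 2) * q"
    and len: "length ys = Suc (n div 2)"
    and sorted: "sorted_wrt (<) ys" and bounds: "-1 \<le> ys ! 0" "ys ! (n div 2) = 0"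
    and sign: "\<And>i. i \<le> n div 2 \<Longrightarrow> 0 < (- 1) ^ (n div 2 - i) * poly q (ys ! i)"
  obtains c zs where "is_f_factorization (Suc n) c zs"
    "\<And>i. i < n div 2 \<Longrightarrow> ys ! i < zs ! i \<and> zs ! i < ys ! Suc i"
proof -
  have "q \<noteq> 0" using q f_poly_neq_0[of "Suc n"] by auto
  have "n = Suc n div 2 + degree q"
    using \<open>q \<noteq> 0\<close> degree_f_poly[of "Suc n"]
    unfolding q by (simp add: degree_mult_eq degree_power_eq)
  then have deg: "degree q = n div 2" by linarith
  have nth_mono: "ys ! i < ys ! j" if "i < j" "j \<le> n div 2" for i j
    using sorted_wrt_nth_less[OF sorted that(1)] that(2) len by simp
  have "ys ! i < ys ! Suc i" if "i < degree q" for i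
    using that deg by (intro nth_mono) auto
  then obtain zs where zs: "length zs = n div 2" "sorted_wrt (<) zs"
    "\<And>i. i < n div 2 \<Longrightarrow> ys ! i < zs ! i \<and> zs ! i < ys ! Suc i"
    "q = smult (lead_coeff q) (\<Prod>x\<leftarrow>zs. [:- x, 1:])"
    using zeros_between_sign_changes[of ys q] len sign unfolding deg by blast
  have "lead_coeff (f_poly (Suc n)) = lead_coeff q"
    unfolding q lead_coeff_mult lead_coeff_power by simp
  then have "0 < lead_coeff q"
    using coeff_f_poly_pos[of n "Suc n"] degree_f_poly[of "Suc n"] by simp
  moreover have "zs ! i \<in> {-1<..<0}" if "i < n div 2" for i
  proof -
    have "ys ! 0 \<le> ys ! i" "ys ! Suc i \<le> ys ! (n div 2)"
      using nth_mono[of 0 i] nth_mono[of "Suc i" "n div 2"] that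
      by (cases "i = 0"; cases "Suc i = n div 2"; force)+
    then show ?thesis using zs(3)[OF that] bounds by auto
  qed
  then have "set zs \<subseteq> {-1<..<0}"
    using zs(1) by (auto simp: set_conv_nth simp del: greaterThanLessThan_iff)
  moreover have "f_poly (Suc n) = smult (lead_coeff q) (\<Prod>x\<leftarrow>f_zeros (Suc n) zs. [:- x, 1:])"
    unfolding f_zeros_prod q by (subst zs(4)) simp
  ultimately have "is_f_factorization (Suc n) (lead_coeff q) zs"
    using zs by (simp add: is_f_factorization_def)
  then show thesis using zs(3) that by blast
qed

text \<open>At a zero of \<open>g\<close> only the derivative term of the new cofactor survives,
  with a negative multiplier. Because the zeros of \<open>g\<close> serve as test points, the same
  argument gives the interlacing.\<close>

lemma is_f_factorization_step:
  assumes n: "1 \<le> n" and fac: "is_f_factorization n c xs"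
  obtains d zs where "is_f_factorization (Suc n) d zs"
    "\<And>i. i < n - 1 \<Longrightarrow> f_zeros (Suc n) zs ! i \<le> f_zeros n xs ! i \<and>
       f_zeros n xs ! i \<le> f_zeros (Suc n) zs ! Suc i"
proof -
  define g where "g = smult c (\<Prod>x\<leftarrow>xs. [:- x, 1:])"
  define k where "k = length xs"
  have c: "0 < c" and sorted: "sorted_wrt (<) xs" and xs: "set xs \<subseteq> {-1<..<0}"
    and k: "k = (n - 1) div 2" and f: "f_poly n = [:1, 1:] ^ (n div 2) * g"
    using fac by (auto simp: is_f_factorization_def f_zeros_prod g_def k_def)
  have root: "poly g (xs ! i) = 0" if "i < k" for i
    using that by (auto simp: g_def poly_linear_factors prod_list_zero_iff k_def)
  have nth_bounds: "-1 < xs ! i" "xs ! i < 0" if "i < k" for i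
    using that xs nth_mem[of i xs] unfolding k_def by fastforce+
  have slope: "0 < (- 1) ^ (k - Suc i) * poly (pderiv g) (xs ! i)" if "i < k" for i
    using sign_pderiv_linear_factors[OF c sorted] that by (simp add: g_def k_def)
  \<comment> \<open>The negative multiplier \<open>b\<close> costs one sign, which raises the
    exponent from \<open>k - Suc i\<close> to \<open>k - i\<close>.\<close>
  have slope': "0 < (- 1) ^ (k - i) * (b * poly (pderiv g) (xs ! i))" if "i < k" "b < 0" for i b
  proof -
    have "k - i = Suc (k - Suc i)" using that by simp
    have "(- 1) ^ (k - i) * (b * poly (pderiv g) (xs ! i))
        = (- b) * ((- 1) ^ (k - Suc i) * poly (pderiv g) (xs ! i))"
      using \<open>k - i = _\<close> by simp
    also have "\<dots> > 0"
      using that(2) by (intro mult_pos_pos slope that(1)) simp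
    finally show ?thesis .
  qed
  have g0: "0 < poly g 0"
    unfolding g_def poly_smult poly_linear_factors
    by (intro mult_pos_pos c prod_list_diff_pos) (use xs in auto)
  have "0 < c * ((- 1) ^ k * (\<Prod>x\<leftarrow>xs. - 1 - x))"
    unfolding k_def by (intro mult_pos_pos[OF c] prod_list_diff_neg) (use xs in auto)
  then have g1: "0 < (- 1) ^ k * poly g (- 1)"
    unfolding g_def poly_smult poly_linear_factors by (simp only: mult.left_commute)
  show thesis
  proof (cases "even n")
    case True
    then obtain m where m: "n = 2 * Suc m"
      using n by (metis evenE mult_0_right not_one_le_zero old.nat.exhaust)
    then have [simp]: "k = m" using k by simp
    define q where "q = [:1, 1 + real (Suc m), real n - 1 - real (Suc m):] * g
      + [:0, 1, 0, -1:] * pderiv g"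
    \<comment> \<open>Here the multiplicity of -1 stays the same and the degree of the cofactor
      grows by one, so -1 is needed as an extra test point.\<close>
    define ys where "ys = - 1 # xs @ [0]"
    have "f_poly (Suc n) = [:1, 1:] ^ (Suc n div 2) * q"
      using f_poly_Suc_factor[OF n f] by (simp add: m q_def)
    moreover have "length ys = Suc (n div 2)" "sorted_wrt (<) ys" "-1 \<le> ys ! 0" "ys ! (n div 2) = 0"
      using sorted xs m k_def by (auto simp: ys_def sorted_wrt_append nth_append)
    moreover have "0 < (- 1) ^ (n div 2 - i) * poly q (ys ! i)" if i: "i \<le> n div 2" for i
    proof -
      consider "i = 0" | j where "i = Suc j" "j < m" | "i = Suc m"
        using i m by (cases i) force+
      then show ?thesis
      proof cases
        case 1
        \<comment> \<open>The derivative term vanishes at -1, and the quadratic takes the value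
          \<open>1 - (m + 2) + m = -1\<close>.\<close>
        have "poly q (- 1) = - poly g (- 1)"
          by (simp add: q_def m algebra_simps)
        then show ?thesis using g1 m 1 by (simp add: ys_def)
      next
        case 2
        then have y: "ys ! i = xs ! j" by (simp add: ys_def nth_append k_def[symmetric])
        have "poly q (xs ! j) = (xs ! j * (1 - (xs ! j)\<^sup>2)) * poly (pderiv g) (xs ! j)"
          using root[of j] 2 by (simp add: q_def algebra_simps power2_eq_square)
        moreover have "xs ! j * (1 - (xs ! j)\<^sup>2) < 0"
          using nth_bounds[of j] 2 by (simp add: mult_less_0_iff power2_less_1_iff abs_less_iff)
        ultimately show ?thesis
          unfolding y using slope'[of j] 2 m by simp
      next
        case 3
        then show ?thesis using g0 m by (simp add: ys_def q_def nth_append k_def[symmetric])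
      qed
    qed
    ultimately obtain d zs where zs: "is_f_factorization (Suc n) d zs"
      "\<And>i. i < n div 2 \<Longrightarrow> ys ! i < zs ! i \<and> zs ! i < ys ! Suc i"
      using f_factorization_of_sign_changes[OF n, of q ys] by blast
    have "-1 < zs ! 0" using zs(2)[of 0] m by (simp add: ys_def)
    moreover have "zs ! i < xs ! i" "xs ! i < zs ! Suc i" if "i < m" for i
      using zs(2)[of i] zs(2)[of "Suc i"] that m by (simp_all add: ys_def nth_append k_def[symmetric])
    ultimately have "f_zeros (Suc n) zs ! i \<le> f_zeros n xs ! i \<and>
       f_zeros n xs ! i \<le> f_zeros (Suc n) zs ! Suc i" if "i < n - 1" for i
    proof -
      assume *: "\<And>i. i < m \<Longrightarrow> zs ! i < xs ! i" "\<And>i. i < m \<Longrightarrow> xs ! i < zs ! Suc i" "-1 < zs ! 0"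
      have div: "n div 2 = Suc m" "Suc n div 2 = Suc m" using m by simp_all
      show ?thesis
      proof (cases "i < Suc m")
        case True
        then show ?thesis using *(3) by (cases "i = m") (simp_all add: nth_f_zeros div)
      next
        case False
        then obtain l where l: "i = Suc m + l" by (metis not_less le_iff_add)
        then have "l < m" using that m by simp
        then show ?thesis using *(1,2)[of l] by (simp add: nth_f_zeros div l less_imp_le)
      qed
    qed
    then show thesis using that zs(1) by blast
  next
    case False
    then obtain m where m: "n = Suc (2 * m)" by (metis oddE Suc_eq_plus1)
    then have [simp]: "k = m" using k by simp
    \<comment> \<open>For \<open>n = 2 * m + 1\<close> both multipliers in
      \<open>f_poly_Suc_factor\<close> contain a factor \<open>1 + x\<close>. Splitting it off
      raises the multiplicity of -1 and leaves this cofactor.\<close>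
    define q where "q = [:1, real m:] * g + [:0, 1, -1:] * pderiv g"
    define ys where "ys = xs @ [0]"
    have "f_poly (Suc n) = [:1, 1:] ^ (Suc n div 2) * q"
    proof -
      have "[:1, 1 + real m, real n - 1 - real m:] = [:1, 1:] * [:1, real m:]"
        "[:0, 1, 0, -1:] = [:1, 1:] * [:0, 1, -1::real:]"
        by (simp_all add: m)
      then show ?thesis
        using f_poly_Suc_factor[OF n f] by (simp add: m q_def algebra_simps
            del: mult_pCons_left mult_pCons_right)
    qed
    moreover have "length ys = Suc (n div 2)" "sorted_wrt (<) ys" "-1 \<le> ys ! 0" "ys ! (n div 2) = 0"
      using sorted xs m k_def by (auto simp: ys_def sorted_wrt_append nth_append less_imp_le nth_bounds)
    moreover have "0 < (- 1) ^ (n div 2 - i) * poly q (ys ! i)" if i: "i \<le> n div 2" for i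
    proof -
      consider "i < m" | "i = m" using i m by force
      then show ?thesis
      proof cases
        case 1
        then have y: "ys ! i = xs ! i" by (simp add: ys_def nth_append k_def[symmetric])
        have "poly q (xs ! i) = (xs ! i * (1 - xs ! i)) * poly (pderiv g) (xs ! i)"
          using root[of i] 1 by (simp add: q_def algebra_simps)
        moreover have "xs ! i * (1 - xs ! i) < 0"
          using nth_bounds[of i] 1 by (simp add: mult_less_0_iff)
        ultimately show ?thesis
          unfolding y using slope'[of i] 1 m by simp
      next
        case 2
        then show ?thesis using g0 m by (simp add: ys_def q_def nth_append k_def[symmetric])
      qed
    qed
    ultimately obtain d zs where zs: "is_f_factorization (Suc n) d zs"
      "\<And>i. i < n div 2 \<Longrightarrow> ys ! i < zs ! i \<and> zs ! i < ys ! Suc i"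
      using f_factorization_of_sign_changes[OF n, of q ys] by blast
    have lower: "xs ! i < zs ! i" if "i < m" for i
      using zs(2)[of i] that m by (simp add: ys_def nth_append k_def[symmetric])
    have upper: "zs ! i < xs ! Suc i" if "Suc i < m" for i
      using zs(2)[of i] that m by (simp add: ys_def nth_append k_def[symmetric])
    have div: "n div 2 = m" "Suc n div 2 = Suc m" using m by simp_all
    have "f_zeros (Suc n) zs ! i \<le> f_zeros n xs ! i \<and>
       f_zeros n xs ! i \<le> f_zeros (Suc n) zs ! Suc i" if "i < n - 1" for i
    proof (cases "i < m")
      case True
      then show ?thesis by (simp add: nth_f_zeros div)
    next
      case False
      \<comment> \<open>The new block of -1 is one longer, so \<open>xs ! l\<close> lies between
        \<open>zs ! (l - 1)\<close> and \<open>zs ! l\<close>, with -1 replacing the former when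
        \<open>l = 0\<close>.\<close>
      then obtain l where l: "i = m + l" by (metis not_less le_iff_add)
      then have "l < m" using that m by simp
      then show ?thesis using lower[of l] upper[of "l - 1"] nth_bounds[of l]
        by (cases l) (simp_all add: nth_f_zeros div l less_imp_le)
    qed
    then show thesis using that zs(1) by blast
  qed
qed

lemma ex_f_factorization:
  assumes "1 \<le> n" shows "\<exists>c xs. is_f_factorization n c xs"
  using assms
proof (induction n rule: dec_induct)
  case base
  have "is_f_factorization 1 2 []"
    by (simp add: is_f_factorization_def f_zeros_def f_poly_1[simplified])
  then show ?case by auto
next
  case (step n)
  then obtain c xs where "is_f_factorization n c xs" by blast
  then show ?case using is_f_factorization_step[OF step(1)] by blast
qed

lemma sorted_f_zeros:
  assumes "is_f_factorization n c xs" shows "sorted (f_zeros n xs)"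
proof -
  have "sorted xs" "\<forall>x\<in>set xs. -1 \<le> x"
    using assms by (auto simp: is_f_factorization_def strict_sorted_iff)
  then show ?thesis by (simp add: f_zeros_def sorted_append)
qed

lemma interlaces_f_poly:
  assumes "1 \<le> n" shows "interlaces (f_poly n) (f_poly (n + 1))"
proof -
  obtain c xs where xs: "is_f_factorization n c xs"
    using ex_f_factorization[OF assms] by blast
  obtain d zs where zs: "is_f_factorization (Suc n) d zs"
    "\<And>i. i < n - 1 \<Longrightarrow> f_zeros (Suc n) zs ! i \<le> f_zeros n xs ! i \<and>
       f_zeros n xs ! i \<le> f_zeros (Suc n) zs ! Suc i"
    using is_f_factorization_step[OF assms xs] by blast
  have "real_rooted (f_poly n)" "zeros (f_poly n) = f_zeros n xs"
    using xs sorted_f_zeros[OF xs]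
    by (auto simp: is_f_factorization_def real_rooted_linear_factors zeros_linear_factors)
  moreover have "real_rooted (f_poly (Suc n))" "zeros (f_poly (Suc n)) = f_zeros (Suc n) zs"
    using zs(1) sorted_f_zeros[OF zs(1)]
    by (auto simp: is_f_factorization_def real_rooted_linear_factors zeros_linear_factors)
  ultimately show ?thesis
    using assms zs(2) by (simp add: interlaces_def degree_f_poly)
qed

lemma zeros_f_poly:
  assumes "1 \<le> n"
  shows "f_poly n \<in> RZ {-1..<0}"
    and "card {x \<in> {-1<..<0}. poly (f_poly n) x = 0} = (n - 1) div 2"
    and "\<forall>x \<in> {-1<..<0}. poly (f_poly n) x = 0 \<longrightarrow> order x (f_poly n) = 1"
    and "order (-1) (f_poly n) = n div 2"
proof -
  obtain c xs where fac: "is_f_factorization n c xs"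
    using ex_f_factorization[OF assms] by blast
  then have c: "c \<noteq> 0" and f: "f_poly n = smult c (\<Prod>x\<leftarrow>f_zeros n xs. [:- x, 1:])"
    and dist: "distinct xs" and xs: "set xs \<subseteq> {-1<..<0}" and len: "length xs = (n - 1) div 2"
    by (auto simp: is_f_factorization_def strict_sorted_iff)
  have "set (f_zeros n xs) \<subseteq> {-1..<0}"
    using xs by (auto simp: f_zeros_def)
  then show "f_poly n \<in> RZ {-1..<0}"
    using c unfolding f RZ_def by (auto simp: complex_zeros_linear_factors)
  have zero_iff: "poly (f_poly n) x = 0 \<longleftrightarrow> x \<in> set xs" if "x \<in> {-1<..<0}" for x
    using that c unfolding f by (auto simp: poly_linear_factors prod_list_zero_iff f_zeros_def)
  then have "{x \<in> {-1<..<0}. poly (f_poly n) x = 0} = set xs"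
    using xs by auto
  then show "card {x \<in> {-1<..<0}. poly (f_poly n) x = 0} = (n - 1) div 2"
    using dist len by (simp add: distinct_card)
  have order: "order x (f_poly n) = (if x = -1 then n div 2 else 0) + count (mset xs) x" for x
    unfolding f using c by (subst order_linear_factors) (auto simp: f_zeros_def)
  show "\<forall>x \<in> {-1<..<0}. poly (f_poly n) x = 0 \<longrightarrow> order x (f_poly n) = 1"
    using zero_iff dist by (auto simp: order distinct_count_atmost_1)
  have "-1 \<notin> set xs" using xs by auto
  then show "order (-1) (f_poly n) = n div 2"
    by (simp add: order count_mset_0_iff not_in_iff[symmetric])
qed

subsection \<open>The zeros of the even and odd parts\<close>

text \<open>As \<open>(\<i> y)^2 = - y^2\<close>, a polynomial in \<open>x^2\<close> is real on the
  imaginary axis.\<close>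

lemma poly_complex_pcompose_square:
  "poly (complex_poly (p \<circ>\<^sub>p [:0, 0, 1:])) (\<i> * of_real y) = of_real (poly p (- y\<^sup>2))"
proof (induction p)
  case (pCons a p)
  have "complex_poly [:0, 0, 1:] = [:0, 0, 1:]" by (simp add: map_poly_pCons)
  then show ?case
    by (simp add: pcompose_pCons complex_poly_add complex_poly_mult map_poly_pCons pCons.IH
        power2_eq_square algebra_simps)
qed simp

text \<open>For \<open>r > 0\<close> the point lies in the right half plane, so
  \<open>arctan (y / r)\<close> is its argument without a branch correction.\<close>

lemma complex_polar_positive_real:
  assumes "0 < r"
  shows "of_real r + \<i> * of_real y = of_real (sqrt (r\<^sup>2 + y\<^sup>2)) * cis (arctan (y / r))"
proof -
  have "r * sqrt (1 + (y / r)\<^sup>2) = sqrt (r\<^sup>2 * (1 + (y / r)\<^sup>2))"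
    using assms by (simp add: real_sqrt_mult)
  also have "r\<^sup>2 * (1 + (y / r)\<^sup>2) = r\<^sup>2 + y\<^sup>2"
    using assms by (simp add: field_simps)
  finally have *: "sqrt (r\<^sup>2 + y\<^sup>2) = r * sqrt (1 + (y / r)\<^sup>2)" by simp
  have "sqrt (1 + (y / r)\<^sup>2) \<noteq> 0"
    by (smt (verit) real_sqrt_gt_zero zero_le_power2)
  then show ?thesis
    unfolding * using assms by (auto simp: complex_eq_iff cos_arctan sin_arctan)
qed

text \<open>
  Along the imaginary axis the argument of \<open>\<Prod>(x + r)\<close> is the increasing function
  \<open>phase rs y = \<Sum>arctan (y / r)\<close>, and the even and odd parts are the real and imaginary parts.
\<close>

definition phase :: "real list \<Rightarrow> real \<Rightarrow> real" where
  "phase rs y = (\<Sum>r\<leftarrow>rs. arctan (y / r))"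

lemma prod_list_polar:
  assumes "\<forall>r\<in>set rs. 0 < r"
  shows "(\<Prod>r\<leftarrow>rs. complex_of_real r + \<i> * of_real y) =
    of_real (\<Prod>r\<leftarrow>rs. sqrt (r\<^sup>2 + y\<^sup>2)) * cis (phase rs y)"
  using assms
  by (induction rs) (simp_all add: phase_def complex_polar_positive_real flip: cis_mult)

lemma phase_mono: "\<forall>r\<in>set rs. 0 < r \<Longrightarrow> a \<le> b \<Longrightarrow> phase rs a \<le> phase rs b"
  unfolding phase_def
  by (intro sum_list_mono) (simp add: arctan_le_iff divide_right_mono less_imp_le)

lemma continuous_phase: "0 \<notin> set rs \<Longrightarrow> continuous_on A (phase rs)"
  unfolding phase_def
  by (induction rs) (auto intro!: continuous_intros)

lemma phase_tendsto:
  "\<forall>r\<in>set rs. 0 < r \<Longrightarrow> (phase rs \<longlongrightarrow> real (length rs) * (pi / 2)) at_top"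
proof (induction rs)
  case (Cons r rs)
  have "filterlim (\<lambda>y. y / r) at_top at_top"
    using Cons.prems
    by (simp add: divide_inverse filterlim_ident filterlim_at_top_mult_tendsto_pos[OF tendsto_const])
  then have "((\<lambda>y. arctan (y / r)) \<longlongrightarrow> pi / 2) at_top"
    using tendsto_arctan_at_top filterlim_compose by blast
  then have "((\<lambda>y. arctan (y / r) + phase rs y) \<longlongrightarrow> pi / 2 + real (length rs) * (pi / 2)) at_top"
    using Cons by (intro tendsto_add) auto
  then show ?case by (simp add: phase_def[abs_def] algebra_simps add_divide_distrib)
qed (simp add: phase_def[abs_def])

text \<open>The phase rises continuously from 0 towards the limit \<open>length rs * pi / 2\<close>,
  which exceeds the required value because \<open>k < length rs\<close>.\<close>

lemma phase_attains:
  assumes "\<forall>r\<in>set rs. 0 < r" "1 \<le> k" "k < length rs"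
  shows "\<exists>y>0. phase rs y = real k * (pi / 2)"
proof -
  have "eventually (\<lambda>y. real k * (pi / 2) < phase rs y) at_top"
    using assms by (intro order_tendstoD(1)[OF phase_tendsto]) auto
  then have "eventually (\<lambda>y. real k * (pi / 2) < phase rs y \<and> 0 < y) at_top"
    using eventually_gt_at_top[of 0] by (rule eventually_conj)
  then obtain b where b: "real k * (pi / 2) < phase rs b" "0 < b"
    by (metis (mono_tags, lifting) eventually_happens trivial_limit_at_top_linorder)
  have phase_0: "phase rs 0 = 0" by (simp add: phase_def)
  have "continuous_on {0..b} (phase rs)"
    using assms(1) by (intro continuous_phase) auto
  then obtain y where y: "0 \<le> y" "phase rs y = real k * (pi / 2)"
    using IVT'[of "phase rs" 0 "real k * (pi / 2)" b] b phase_0 by auto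
  moreover have "y \<noteq> 0" using y(2) assms(2) phase_0 by auto
  ultimately show ?thesis by (intro exI[of _ y]) auto
qed

text \<open>Take \<open>y k\<close> where the phase equals \<open>k * pi / 2\<close>. For odd
  \<open>k\<close> the cosine vanishes, hence \<open>p\<close>; for even \<open>k\<close> the sine
  vanishes, hence \<open>q\<close> after cancelling \<open>y k > 0\<close>.\<close>

lemma zeros_even_odd_parts:
  fixes p q :: "real poly"
  assumes f: "p \<circ>\<^sub>p [:0, 0, 1:] + [:0, 1:] * (q \<circ>\<^sub>p [:0, 0, 1:]) = smult c (\<Prod>x\<leftarrow>xs. [:- x, 1:])"
    and neg: "set xs \<subseteq> {..<0}"
  obtains y :: "nat \<Rightarrow> real" where
    "\<And>k. 1 \<le> k \<Longrightarrow> k < length xs \<Longrightarrow> 0 < y k"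
    "\<And>k l. 1 \<le> k \<Longrightarrow> k < l \<Longrightarrow> l < length xs \<Longrightarrow> y k < y l"
    "\<And>k. 1 \<le> k \<Longrightarrow> k < length xs \<Longrightarrow> odd k \<Longrightarrow> poly p (- (y k)\<^sup>2) = 0"
    "\<And>k. 1 \<le> k \<Longrightarrow> k < length xs \<Longrightarrow> even k \<Longrightarrow> poly q (- (y k)\<^sup>2) = 0"
proof -
  define rs where "rs = map uminus xs"
  have pos: "\<forall>r\<in>set rs. 0 < r" and len: "length rs = length xs"
    using neg by (auto simp: rs_def)
  obtain y where y: "\<And>k. 1 \<le> k \<Longrightarrow> k < length xs \<Longrightarrow> 0 < y k \<and> phase rs (y k) = real k * (pi / 2)"
    using phase_attains[OF pos] unfolding len by metis
  have parts: "poly p (- t\<^sup>2) = c * (\<Prod>r\<leftarrow>rs. sqrt (r\<^sup>2 + t\<^sup>2)) * cos (phase rs t)"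
    "t * poly q (- t\<^sup>2) = c * (\<Prod>r\<leftarrow>rs. sqrt (r\<^sup>2 + t\<^sup>2)) * sin (phase rs t)" for t
  proof -
    have "poly (complex_poly (p \<circ>\<^sub>p [:0, 0, 1:] + [:0, 1:] * (q \<circ>\<^sub>p [:0, 0, 1:]))) (\<i> * of_real t) =
        of_real (poly p (- t\<^sup>2)) + \<i> * of_real (t * poly q (- t\<^sup>2))"
      unfolding complex_poly_add complex_poly_mult
      by (simp add: poly_complex_pcompose_square map_poly_pCons del: mult_pCons_left)
    moreover have "poly (complex_poly (smult c (\<Prod>x\<leftarrow>xs. [:- x, 1:]))) (\<i> * of_real t) =
        of_real c * (\<Prod>r\<leftarrow>rs. complex_of_real r + \<i> * of_real t)"
      unfolding complex_poly_linear_factors poly_smult poly_linear_factors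
      by (simp add: rs_def comp_def add.commute)
    ultimately have eq: "of_real (poly p (- t\<^sup>2)) + \<i> * of_real (t * poly q (- t\<^sup>2)) =
        complex_of_real (c * (\<Prod>r\<leftarrow>rs. sqrt (r\<^sup>2 + t\<^sup>2))) * cis (phase rs t)"
      unfolding f prod_list_polar[OF pos] by (simp add: mult.assoc)
    from arg_cong[OF eq, of Re] arg_cong[OF eq, of Im]
    show "poly p (- t\<^sup>2) = c * (\<Prod>r\<leftarrow>rs. sqrt (r\<^sup>2 + t\<^sup>2)) * cos (phase rs t)"
      "t * poly q (- t\<^sup>2) = c * (\<Prod>r\<leftarrow>rs. sqrt (r\<^sup>2 + t\<^sup>2)) * sin (phase rs t)"
      by simp_all
  qed
  show thesis
  proof (rule that[of y])
    fix k l :: nat assume kl: "1 \<le> k" "k < l" "l < length xs"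
    have "real k * (pi / 2) < real l * (pi / 2)"
      using kl by (intro mult_strict_right_mono) auto
    moreover have "phase rs (y k) = real k * (pi / 2)" "phase rs (y l) = real l * (pi / 2)"
      using y[of k] y[of l] kl by auto
    \<comment> \<open>Since the phase is monotone, a strictly smaller phase forces a strictly
      smaller point.\<close>
    ultimately have "phase rs (y k) < phase rs (y l)" by (simp only:)
    then show "y k < y l"
      using phase_mono[OF pos, of "y l" "y k"] by (meson not_le)
  next
    fix k assume k: "1 \<le> k" "k < length xs" "odd k"
    then obtain j where "k = 2 * j + 1" by (auto elim: oddE)
    then have "phase rs (y k) = real j * pi + pi / 2"
      using y[OF k(1,2)] by (simp add: algebra_simps)
    then have "cos (phase rs (y k)) = 0" by (simp add: cos_add)
    then show "poly p (- (y k)\<^sup>2) = 0" by (simp add: parts)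
  next
    fix k assume k: "1 \<le> k" "k < length xs" "even k"
    then obtain j where "k = 2 * j" by (auto elim: evenE)
    then have "phase rs (y k) = real j * pi"
      using y[OF k(1,2)] by simp
    then have "y k * poly q (- (y k)\<^sup>2) = 0"
      unfolding parts by simp
    then show "poly q (- (y k)\<^sup>2) = 0" using y[OF k(1,2)] by auto
  qed (use y in blast)
qed

section \<open>Zero lists of the even and odd parts and their interlacing\<close>

lemma coeff_xi_poly_f_poly: "coeff (xi_poly n) k = coeff (f_poly n) (2 * k) / 2"
  by (simp add: coeff_xi_poly coeff_f_poly)

lemma coeff_zeta_poly_f_poly: "coeff (zeta_poly n) k = coeff (f_poly n) (2 * k + 1)"
  by (simp add: coeff_zeta_poly coeff_f_poly)

lemma degree_xi_poly:
  assumes "1 \<le> n" shows "degree (xi_poly n) = (n - 1) div 2"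
proof (rule antisym)
  show "degree (xi_poly n) \<le> (n - 1) div 2"
    using assms by (intro degree_le allI impI) (simp add: coeff_xi_poly_f_poly coeff_f_poly_eq_0)
  have "2 * ((n - 1) div 2) < n" using assms by linarith
  then show "(n - 1) div 2 \<le> degree (xi_poly n)"
    using coeff_f_poly_pos by (intro le_degree) (force simp: coeff_xi_poly_f_poly)
qed

lemma degree_zeta_poly:
  assumes "2 \<le> n" shows "degree (zeta_poly n) = (n - 2) div 2"
proof (rule antisym)
  show "degree (zeta_poly n) \<le> (n - 2) div 2"
    using assms by (intro degree_le allI impI) (simp add: coeff_zeta_poly_f_poly coeff_f_poly_eq_0)
  have "2 * ((n - 2) div 2) + 1 < n" using assms by linarith
  then show "(n - 2) div 2 \<le> degree (zeta_poly n)"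
    using coeff_f_poly_pos by (intro le_degree) (force simp: coeff_zeta_poly_f_poly)
qed

lemma xi_poly_neq_0: "1 \<le> n \<Longrightarrow> xi_poly n \<noteq> 0"
  using coeff_f_poly_pos[of 0 n] coeff_xi_poly_f_poly[of n 0] by auto

lemma zeta_poly_neq_0: "2 \<le> n \<Longrightarrow> zeta_poly n \<noteq> 0"
  using coeff_f_poly_pos[of 1 n] coeff_zeta_poly_f_poly[of n 0] by auto

text \<open>As many distinct negative zeros as the degree exhaust the zeros, so the factorization
  lemmas apply to \<open>p\<close> itself.\<close>

lemma zeros_of_root_list:
  fixes p :: "real poly"
  assumes "p \<noteq> 0" "sorted_wrt (<) xs" "length xs = degree p" "\<forall>x\<in>set xs. x < 0 \<and> poly p x = 0"
  shows "zeros p = xs" "real_rooted p" "only_real_negative_simple_zeros p"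
proof -
  have dist: "distinct xs" "sorted xs" using assms(2) by (simp_all add: strict_sorted_iff)
  then have p: "p = smult (lead_coeff p) (\<Prod>x\<leftarrow>xs. [:- x, 1:])"
    using assms by (intro linear_factors_eqI) auto
  have c: "lead_coeff p \<noteq> 0" using assms(1) by simp
  have neg: "set xs \<subseteq> {..<0}" using assms(4) by auto
  show "zeros p = xs" "real_rooted p" "only_real_negative_simple_zeros p"
    using zeros_linear_factors[OF c dist(2)] real_rooted_linear_factors[OF c, of xs]
      only_real_negative_simple_zeros_linear_factors[OF c dist(1) neg]
    unfolding p[symmetric] .
qed

text \<open>
  The witness \<open>y\<close> enumerates, in increasing order, the square roots of the negated zeros of
  \<open>\<xi>\<^sub>n\<close> (odd indices) and \<open>\<zeta>\<^sub>n\<close> (even indices).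
\<close>

lemma zeros_xi_zeta_poly:
  assumes n: "1 \<le> n"
  obtains y :: "nat \<Rightarrow> real" where
    "\<And>k l. 1 \<le> k \<Longrightarrow> k < l \<Longrightarrow> l < n - 1 \<Longrightarrow> - (y l)\<^sup>2 < - (y k)\<^sup>2"
    "zeros (xi_poly n) = map (\<lambda>i. - (y (2 * ((n - 1) div 2 - Suc i) + 1))\<^sup>2) [0..<(n - 1) div 2]"
    "real_rooted (xi_poly n)" "only_real_negative_simple_zeros (xi_poly n)"
    "2 \<le> n \<Longrightarrow>
       zeros (zeta_poly n) = map (\<lambda>i. - (y (2 * ((n - 2) div 2 - i)))\<^sup>2) [0..<(n - 2) div 2]"
    "2 \<le> n \<Longrightarrow> real_rooted (zeta_poly n)"
    "2 \<le> n \<Longrightarrow> only_real_negative_simple_zeros (zeta_poly n)"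
proof -
  obtain c xs where fac: "is_f_factorization n c xs"
    using ex_f_factorization[OF n] by blast
  then have f: "f_poly n = smult c (\<Prod>x\<leftarrow>f_zeros n xs. [:- x, 1:])"
    and neg: "set (f_zeros n xs) \<subseteq> {..<0}" and len: "length (f_zeros n xs) = n - 1"
    using n by (auto simp: is_f_factorization_def f_zeros_def)
  have "smult 2 (xi_poly n) \<circ>\<^sub>p [:0, 0, 1:] + [:0, 1:] * (zeta_poly n \<circ>\<^sub>p [:0, 0, 1:])
      = smult c (\<Prod>x\<leftarrow>f_zeros n xs. [:- x, 1:])"
    unfolding f[symmetric] f_poly_def pcompose_smult ..
  from zeros_even_odd_parts[OF this neg, unfolded len]
  obtain y where pos: "\<And>k. 1 \<le> k \<Longrightarrow> k < n - 1 \<Longrightarrow> 0 < y k"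
    and less: "\<And>k l. 1 \<le> k \<Longrightarrow> k < l \<Longrightarrow> l < n - 1 \<Longrightarrow> y k < y l"
    and xi: "\<And>k. 1 \<le> k \<Longrightarrow> k < n - 1 \<Longrightarrow> odd k \<Longrightarrow> poly (smult 2 (xi_poly n)) (- (y k)\<^sup>2) = 0"
    and zeta: "\<And>k. 1 \<le> k \<Longrightarrow> k < n - 1 \<Longrightarrow> even k \<Longrightarrow> poly (zeta_poly n) (- (y k)\<^sup>2) = 0"
    by blast
  have mono: "- (y l)\<^sup>2 < - (y k)\<^sup>2" if "1 \<le> k" "k < l" "l < n - 1" for k l
    using less[OF that] pos[of k] that by (simp add: power_strict_mono)
  \<comment> \<open>Negated squares reverse the order, so the indices descend:
    \<open>2 * d - 1, ..., 3, 1\<close> here with \<open>d = (n - 1) div 2\<close>, and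
    \<open>2 * e, ..., 4, 2\<close> below with \<open>e = (n - 2) div 2\<close>.\<close>
  let ?xs = "map (\<lambda>i. - (y (2 * ((n - 1) div 2 - Suc i) + 1))\<^sup>2) [0..<(n - 1) div 2]"
  let ?zs = "map (\<lambda>i. - (y (2 * ((n - 2) div 2 - i)))\<^sup>2) [0..<(n - 2) div 2]"
  have "sorted_wrt (<) ?xs"
    by (rule sorted_wrt_less_nth_SucI) (simp del: neg_less_iff_less, rule mono; linarith)
  moreover have "x < 0 \<and> poly (xi_poly n) x = 0" if "x \<in> set ?xs" for x
  proof -
    obtain i where i: "i < (n - 1) div 2" and x: "x = - (y (2 * ((n - 1) div 2 - Suc i) + 1))\<^sup>2"
      using \<open>x \<in> set ?xs\<close> by auto
    have "2 * ((n - 1) div 2 - Suc i) + 1 < n - 1" using i by linarith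
    then show ?thesis
      using pos[of "2 * ((n - 1) div 2 - Suc i) + 1"] xi[of "2 * ((n - 1) div 2 - Suc i) + 1"]
      unfolding x by simp
  qed
  ultimately have xi_zeros: "zeros (xi_poly n) = ?xs" "real_rooted (xi_poly n)"
    "only_real_negative_simple_zeros (xi_poly n)"
    using zeros_of_root_list[of "xi_poly n" ?xs] xi_poly_neq_0[OF n] degree_xi_poly[OF n]
    by simp_all
  have zeta_zeros: "zeros (zeta_poly n) = ?zs" "real_rooted (zeta_poly n)"
    "only_real_negative_simple_zeros (zeta_poly n)" if "2 \<le> n"
  proof -
    have "sorted_wrt (<) ?zs"
      by (rule sorted_wrt_less_nth_SucI) (simp del: neg_less_iff_less, rule mono; linarith)
    moreover have "x < 0 \<and> poly (zeta_poly n) x = 0" if "x \<in> set ?zs" for x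
    proof -
      obtain i where i: "i < (n - 2) div 2" and x: "x = - (y (2 * ((n - 2) div 2 - i)))\<^sup>2"
        using \<open>x \<in> set ?zs\<close> by auto
      have "2 * ((n - 2) div 2 - i) < n - 1" "1 \<le> 2 * ((n - 2) div 2 - i)" using i by linarith+
      then show ?thesis
        using pos[of "2 * ((n - 2) div 2 - i)"] zeta[of "2 * ((n - 2) div 2 - i)"]
        unfolding x by simp
    qed
    ultimately show "zeros (zeta_poly n) = ?zs" "real_rooted (zeta_poly n)"
      "only_real_negative_simple_zeros (zeta_poly n)"
      using zeros_of_root_list[of "zeta_poly n" ?zs] zeta_poly_neq_0[OF that] degree_zeta_poly[OF that]
      by simp_all
  qed
  show thesis
    by (rule that[of y]) (use mono xi_zeros zeta_zeros in blast)+
qed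

text \<open>The indices of \<open>y\<close> run from 1 to \<open>2 * n - 2\<close>. The last is
  even, so the smallest zero belongs to \<open>zeta_poly\<close>, and the two kinds then
  alternate.\<close>

lemma alternates_left_zeta_xi:
  assumes "1 \<le> n" shows "alternates_left (zeta_poly (2 * n)) (xi_poly (2 * n))"
proof -
  have n: "1 \<le> 2 * n" "2 \<le> 2 * n" using assms by simp_all
  have div: "(2 * n - 1) div 2 = n - 1" "(2 * n - 2) div 2 = n - 1" using assms by simp_all
  obtain y :: "nat \<Rightarrow> real" where
    mono: "\<And>k l. 1 \<le> k \<Longrightarrow> k < l \<Longrightarrow> l < 2 * n - 1 \<Longrightarrow> - (y l)\<^sup>2 < - (y k)\<^sup>2"
    and xi: "zeros (xi_poly (2 * n)) = map (\<lambda>i. - (y (2 * (n - 1 - Suc i) + 1))\<^sup>2) [0..<n - 1]"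
      "real_rooted (xi_poly (2 * n))"
    and zeta: "zeros (zeta_poly (2 * n)) = map (\<lambda>i. - (y (2 * (n - 1 - i)))\<^sup>2) [0..<n - 1]"
      "real_rooted (zeta_poly (2 * n))"
    using zeros_xi_zeta_poly[OF n(1)] n(2) unfolding div by metis
  have "zeros (zeta_poly (2 * n)) ! i \<le> zeros (xi_poly (2 * n)) ! i" if "i < n - 1" for i
    unfolding xi zeta using that by (simp_all del: neg_le_iff_le) (rule less_imp_le, rule mono; linarith)+
  moreover have "zeros (xi_poly (2 * n)) ! i \<le> zeros (zeta_poly (2 * n)) ! (i + 1)"
    if "i + 1 < n - 1" for i
    unfolding xi zeta using that by (simp_all del: neg_le_iff_le) (rule less_imp_le, rule mono; linarith)+
  ultimately show ?thesis
    using xi(2) zeta(2) degree_xi_poly[OF n(1)] degree_zeta_poly[OF n(2)]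
    unfolding alternates_left_def div by simp
qed

text \<open>Now the indices run from 1 to \<open>2 * n - 1\<close>. Both ends are odd, so
  \<open>xi_poly\<close> owns the smallest and the largest zero.\<close>

lemma interlaces_zeta_xi:
  assumes "1 \<le> n" shows "interlaces (zeta_poly (2 * n + 1)) (xi_poly (2 * n + 1))"
proof -
  have n: "1 \<le> 2 * n + 1" "2 \<le> 2 * n + 1" using assms by simp_all
  have div: "(2 * n + 1 - 1) div 2 = n" "(2 * n + 1 - 2) div 2 = n - 1" using assms by simp_all
  obtain y :: "nat \<Rightarrow> real" where
    mono: "\<And>k l. 1 \<le> k \<Longrightarrow> k < l \<Longrightarrow> l < 2 * n + 1 - 1 \<Longrightarrow> - (y l)\<^sup>2 < - (y k)\<^sup>2"
    and xi: "zeros (xi_poly (2 * n + 1)) = map (\<lambda>i. - (y (2 * (n - Suc i) + 1))\<^sup>2) [0..<n]"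
      "real_rooted (xi_poly (2 * n + 1))"
    and zeta: "zeros (zeta_poly (2 * n + 1)) = map (\<lambda>i. - (y (2 * (n - 1 - i)))\<^sup>2) [0..<n - 1]"
      "real_rooted (zeta_poly (2 * n + 1))"
    using zeros_xi_zeta_poly[OF n(1)] n(2) unfolding div by metis
  have "zeros (xi_poly (2 * n + 1)) ! i \<le> zeros (zeta_poly (2 * n + 1)) ! i"
    "zeros (zeta_poly (2 * n + 1)) ! i \<le> zeros (xi_poly (2 * n + 1)) ! (i + 1)" if "i < n - 1" for i
  proof -
    have i: "i < n" "Suc i < n" using that by simp_all
    then show "zeros (xi_poly (2 * n + 1)) ! i \<le> zeros (zeta_poly (2 * n + 1)) ! i"
      "zeros (zeta_poly (2 * n + 1)) ! i \<le> zeros (xi_poly (2 * n + 1)) ! (i + 1)"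
      unfolding xi zeta using that
      by (simp_all del: neg_le_iff_le) (rule less_imp_le, rule mono; linarith)+
  qed
  then show ?thesis
    using xi(2) zeta(2) degree_xi_poly[OF n(1)] degree_zeta_poly[OF n(2)] assms
    unfolding interlaces_def div by simp
qed

text \<open>The claims about \<open>zeta_poly\<close> start at index 2, because
  \<open>zeta_poly 1\<close> is the zero polynomial by \<open>zeta_poly_1\<close>.\<close>

theorem theorem2:
  shows "f_poly 1 = [:2:] \<and>
    (\<forall>n\<ge>1. f_poly (n + 1) =
        [:1, 1, real n - 1:] * f_poly n + [:0, 1:] * [:1, 0, -1:] * pderiv (f_poly n)) \<and>
    (\<forall>n\<ge>1. f_poly n \<in> RZ {-1..<0} \<and>
        interlaces (f_poly n) (f_poly (n + 1)) \<and>
        card {x \<in> {-1<..<0}. poly (f_poly n) x = 0} = (n - 1) div 2 \<and>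
        (\<forall>x \<in> {-1<..<0}. poly (f_poly n) x = 0 \<longrightarrow> order x (f_poly n) = 1) \<and>
        order (-1) (f_poly n) = n div 2) \<and>
    (\<forall>n\<ge>1. only_real_negative_simple_zeros (xi_poly n)) \<and>
    (\<forall>n\<ge>2. only_real_negative_simple_zeros (zeta_poly n)) \<and>
    (\<forall>n\<ge>1. alternates_left (zeta_poly (2 * n)) (xi_poly (2 * n))) \<and>
    (\<forall>n\<ge>1. interlaces (zeta_poly (2 * n + 1)) (xi_poly (2 * n + 1)))"
proof (intro conjI allI impI)
  show "f_poly 1 = [:2:]" by (rule f_poly_1)
next
  fix n :: nat assume n: "1 \<le> n"
  show "f_poly (n + 1) =
      [:1, 1, real n - 1:] * f_poly n + [:0, 1:] * [:1, 0, -1:] * pderiv (f_poly n)"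
    unfolding Suc_eq_plus1[symmetric] by (rule f_poly_Suc[OF n])
  show "f_poly n \<in> RZ {-1..<0}"
    "card {x \<in> {-1<..<0}. poly (f_poly n) x = 0} = (n - 1) div 2"
    "\<forall>x \<in> {-1<..<0}. poly (f_poly n) x = 0 \<longrightarrow> order x (f_poly n) = 1"
    "order (-1) (f_poly n) = n div 2"
    by (rule zeros_f_poly[OF n])+
  show "interlaces (f_poly n) (f_poly (n + 1))"
    by (rule interlaces_f_poly[OF n])
  show "only_real_negative_simple_zeros (xi_poly n)"
    using zeros_xi_zeta_poly[OF n] by blast
  show "alternates_left (zeta_poly (2 * n)) (xi_poly (2 * n))"
    by (rule alternates_left_zeta_xi[OF n])
  show "interlaces (zeta_poly (2 * n + 1)) (xi_poly (2 * n + 1))"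
    by (rule interlaces_zeta_xi[OF n])
next
  fix n :: nat assume n: "2 \<le> n"
  then show "only_real_negative_simple_zeros (zeta_poly n)"
    using zeros_xi_zeta_poly[of n] by (metis one_le_numeral order_trans)
qed

end
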